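(* Every allowed formula is domain independent.
   Context: Language: finite set $\mathcal R$ of relation symbols with arities $\delta(r)$; finite linearly ordered set $\mathcal X$ of variables. Formulas: $1$; $r(x_1,\ldots,x_n)$ ($\delta(r)=n$); $(x\approx y)$ (equality is not a relation symbol); $\neg\varphi$; $(\varphi\wedge\psi)$; $(\varphi\vee\psi)$; $(\exists x)\varphi$. $\mathrm{FV}$ denotes free variables as usual ($\mathrm{FV}(1)=\emptyset$, $\mathrm{FV}(x\approx y)=\{x,y\}$, etc.). A structure $M$: nonempty finite set $M$ with $r^M\subseteq M^{\delta(r)}$. $\mathcal V=M^{\mathcal X}$; $\overline V=\mathcal V\setminus V$; $u=_xv$ iff $u,v$ agree off $x$; $\mathrm C_x(V)=\{v:\exists u\in V,u=_xv\}$; $\mathrm D_{xy}=\{v:v(x)=v(y)\}$. Value: $\|1\|=\mathcal V$, $\|r(x_1,\ldots,x_n)\|=\{v:(v(x_1),\ldots,v(x_n))\in r^M\}$, $\|x\approx y\|=\mathrm D_{xy}$, $\|\neg\varphi\|=\overline{\|\varphi\|}$, $\wedge\mapsto\cap$, $\vee\mapsto\cup$, $\|(\exists x)\varphi\|=\mathrm C_x(\|\varphi\|)$. For $V\subseteq\mathcal V$ and $X\subseteq\mathcal X$, $\pi_X(V)=\{v|_X:v\in V\}$. Two structures $M_1,M_2$ differ only in domains if $r^{M_1}=r^{M_2}$ for all $r\in\mathcal R$. A formula $\varphi$ is domain independent if $\pi_{\mathrm{FV}(\varphi)}(\|\varphi\|_{M_1})=\pi_{\mathrm{FV}(\varphi)}(\|\varphi\|_{M_2})$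 for all structures $M_1,M_2$ differing only in domains. Allowed formulas: in the following recursive definitions $\varphi\vee\psi$ is treated as $\neg(\neg\varphi\wedge\neg\psi)$. $\mathrm{Eq}(R)$ is the least equivalence on $\mathcal X$ containing $R$, $\mathrm{id}_{\mathcal X}$ the identity. $eq(1)=coeq(1)=eq(r(\ldots))=coeq(r(\ldots))=coeq(x\approx y)=\mathrm{id}_{\mathcal X}$, $eq(x_1\approx x_2)=\mathrm{Eq}(\{\langle x_1,x_2\rangle\})$; $eq(\neg\varphi)=coeq(\varphi)$, $coeq(\neg\varphi)=eq(\varphi)$; $eq(\varphi\wedge\psi)=\mathrm{Eq}(eq(\varphi)\cup eq(\psi))$, $coeq(\varphi\wedge\psi)=coeq(\varphi)\cap coeq(\psi)$; $eq((\exists x)\varphi)=\mathrm{Eq}(eq(\varphi)\cap(\mathcal X\setminus\{x\})^2)$, likewise $coeq$. $\mathrm{cl}_E(X)=\{y:\langle x,y\rangle\in E,\ x\in X\}$. $gen_0(1)=cogen_0(1)=\emptyset$; $gen_0(r(x_1,\ldots,x_n))=\{x_1,\ldots,x_n\}$, $cogen_0(r(\ldots))=\emptyset$; $gen_0(x\approx y)=cogen_0(x\approx y)=\emptyset$; $gen_0(\neg\varphi)=cogen_0(\varphi)$, $cogen_0(\neg\varphi)=gen_0(\varphi)$; $gen_0(\varphi\wedge\psi)=\mathrm{cl}_{eq(\varphi\wedge\psi)}(gen_0(\varphi)\cup gen_0(\psi))$, $cogen_0(\varphi\wedge\psi)=cogen_0(\varphi)\cap cogen_0(\psi)$; $gen_0((\exists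 x)\varphi)=gen_0(\varphi)\setminus\{x\}$, $cogen_0((\exists x)\varphi)=cogen_0(\varphi)\setminus\{x\}$. A formula $\varphi$ is allowed if $\mathrm{FV}(\varphi)=gen_0(\varphi)$ and every subformula $(\exists x)\psi$ of $\varphi$ satisfies $x\in gen_0(\psi)$. *)

theory Defs
  imports Main "HOL-Library.FuncSet"
begin

datatype ('r, 'x) fm =
    One
  | Atom 'r "'x list"
  | Equal 'x 'x
  | Neg "('r, 'x) fm"
  | And "('r, 'x) fm" "('r, 'x) fm"
  | Or "('r, 'x) fm" "('r, 'x) fm"
  | Ex 'x "('r, 'x) fm"

text \<open>
  A language consists of a set \<open>R\<close> of relation symbols with arities \<open>\<delta>\<close> and a set \<open>X\<close> of
  variables, all given as explicit parameters, so that \<open>R\<close> and \<open>X\<close> may also be empty.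
  The raw terms of type \<open>fm\<close> that belong to the language are singled out here.
\<close>

primrec is_formula :: "'r set \<Rightarrow> ('r \<Rightarrow> nat) \<Rightarrow> 'x set \<Rightarrow> ('r, 'x) fm \<Rightarrow> bool" where
  "is_formula R \<delta> X One \<longleftrightarrow> True"
| "is_formula R \<delta> X (Atom r xs) \<longleftrightarrow> r \<in> R \<and> length xs = \<delta> r \<and> set xs \<subseteq> X"
| "is_formula R \<delta> X (Equal x y) \<longleftrightarrow> x \<in> X \<and> y \<in> X"
| "is_formula R \<delta> X (Neg \<phi>) \<longleftrightarrow> is_formula R \<delta> X \<phi>"
| "is_formula R \<delta> X (And \<phi> \<psi>) \<longleftrightarrow> is_formula R \<delta> X \<phi> \<and> is_formula R \<delta> X \<psi>"
| "is_formula R \<delta> X (Or \<phi> \<psi>) \<longleftrightarrow> is_formula R \<delta> X \<phi> \<and> is_formula R \<delta> X \<psi>"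
| "is_formula R \<delta> X (Ex x \<phi>) \<longleftrightarrow> x \<in> X \<and> is_formula R \<delta> X \<phi>"

primrec FV :: "('r, 'x) fm \<Rightarrow> 'x set" where
  "FV One = {}"
| "FV (Atom r xs) = set xs"
| "FV (Equal x y) = {x, y}"
| "FV (Neg \<phi>) = FV \<phi>"
| "FV (And \<phi> \<psi>) = FV \<phi> \<union> FV \<psi>"
| "FV (Or \<phi> \<psi>) = FV \<phi> \<union> FV \<psi>"
| "FV (Ex x \<phi>) = FV \<phi> - {x}"

primrec subformulas :: "('r, 'x) fm \<Rightarrow> ('r, 'x) fm set" where
  "subformulas One = {One}"
| "subformulas (Atom r xs) = {Atom r xs}"
| "subformulas (Equal x y) = {Equal x y}"
| "subformulas (Neg \<phi>) = insert (Neg \<phi>) (subformulas \<phi>)"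
| "subformulas (And \<phi> \<psi>) = insert (And \<phi> \<psi>) (subformulas \<phi> \<union> subformulas \<psi>)"
| "subformulas (Or \<phi> \<psi>) = insert (Or \<phi> \<psi>) (subformulas \<phi> \<union> subformulas \<psi>)"
| "subformulas (Ex x \<phi>) = insert (Ex x \<phi>) (subformulas \<phi>)"


text \<open>
  Structures have their domains inside an arbitrary type \<open>'a\<close>, so that relations of structures
  with different domains can be compared. Tuples are lists of the appropriate length.
\<close>

record ('a, 'r) struct =
  dom :: "'a set"
  rel :: "'r \<Rightarrow> 'a list set"

definition is_structure :: "'r set \<Rightarrow> ('r \<Rightarrow> nat) \<Rightarrow> ('a, 'r) struct \<Rightarrow> bool" where
  "is_structure R \<delta> M \<longleftrightarrow> finite (dom M) \<and> dom M \<noteq> {} \<and>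
     (\<forall>r\<in>R. rel M r \<subseteq> {as. length as = \<delta> r \<and> set as \<subseteq> dom M})"

definition valuations :: "'x set \<Rightarrow> ('a, 'r) struct \<Rightarrow> ('x \<Rightarrow> 'a) set" where
  "valuations X M = X \<rightarrow>\<^sub>E dom M"

definition agree_off :: "'x set \<Rightarrow> 'x \<Rightarrow> ('x \<Rightarrow> 'a) \<Rightarrow> ('x \<Rightarrow> 'a) \<Rightarrow> bool" where
  "agree_off X x u v \<longleftrightarrow> (\<forall>y \<in> X - {x}. u y = v y)"

definition cyl :: "'x set \<Rightarrow> ('a, 'r) struct \<Rightarrow> 'x \<Rightarrow> ('x \<Rightarrow> 'a) set \<Rightarrow> ('x \<Rightarrow> 'a) set" where
  "cyl X M x V = {v \<in> valuations X M. \<exists>u\<in>V. agree_off X x u v}"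

definition diag :: "'x set \<Rightarrow> ('a, 'r) struct \<Rightarrow> 'x \<Rightarrow> 'x \<Rightarrow> ('x \<Rightarrow> 'a) set" where
  "diag X M x y = {v \<in> valuations X M. v x = v y}"

primrec val :: "'x set \<Rightarrow> ('a, 'r) struct \<Rightarrow> ('r, 'x) fm \<Rightarrow> ('x \<Rightarrow> 'a) set" where
  "val X M One = valuations X M"
| "val X M (Atom r xs) = {v \<in> valuations X M. map v xs \<in> rel M r}"
| "val X M (Equal x y) = diag X M x y"
| "val X M (Neg \<phi>) = valuations X M - val X M \<phi>"
| "val X M (And \<phi> \<psi>) = val X M \<phi> \<inter> val X M \<psi>"
| "val X M (Or \<phi> \<psi>) = val X M \<phi> \<union> val X M \<psi>"
| "val X M (Ex x \<phi>) = cyl X M x (val X M \<phi>)"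

definition proj :: "'x set \<Rightarrow> ('x \<Rightarrow> 'a) set \<Rightarrow> ('x \<Rightarrow> 'a) set" where
  "proj Y V = (\<lambda>v. restrict v Y) ` V"

definition differ_only_in_domains ::
    "'r set \<Rightarrow> ('a, 'r) struct \<Rightarrow> ('a, 'r) struct \<Rightarrow> bool" where
  "differ_only_in_domains R M\<^sub>1 M\<^sub>2 \<longleftrightarrow> (\<forall>r\<in>R. rel M\<^sub>1 r = rel M\<^sub>2 r)"

text \<open>
  HOL cannot quantify over types inside a formula, so the type \<open>'a\<close> in which the domains live
  is a parameter; it is universally quantified at theorem level.
\<close>

definition domain_independent ::
    "'a itself \<Rightarrow> 'r set \<Rightarrow> ('r \<Rightarrow> nat) \<Rightarrow> 'x set \<Rightarrow> ('r, 'x) fm \<Rightarrow> bool" where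
  "domain_independent _ R \<delta> X \<phi> \<longleftrightarrow>
     (\<forall>M\<^sub>1 M\<^sub>2 :: ('a, 'r) struct.
        is_structure R \<delta> M\<^sub>1 \<longrightarrow> is_structure R \<delta> M\<^sub>2 \<longrightarrow> differ_only_in_domains R M\<^sub>1 M\<^sub>2 \<longrightarrow>
        proj (FV \<phi>) (val X M\<^sub>1 \<phi>) = proj (FV \<phi>) (val X M\<^sub>2 \<phi>))"


definition Eq :: "'x set \<Rightarrow> ('x \<times> 'x) set \<Rightarrow> ('x \<times> 'x) set" where
  "Eq X S = \<Inter> {E. equiv X E \<and> S \<subseteq> E}"

text \<open>
  In the following recursions \<open>Or \<phi> \<psi>\<close> is treated as \<open>Neg (And (Neg \<phi>) (Neg \<psi>))\<close>; its clauses
  are what results from unfolding the clauses for \<open>Neg\<close> and \<open>And\<close>, as the lemmas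
  \<open>eq_coeq_Or\<close> and \<open>gen_cogen_Or\<close> confirm.
\<close>

fun eq coeq :: "'x set \<Rightarrow> ('r, 'x) fm \<Rightarrow> ('x \<times> 'x) set" where
  "eq X One = Id_on X"
| "eq X (Atom r xs) = Id_on X"
| "eq X (Equal x y) = Eq X {(x, y)}"
| "eq X (Neg \<phi>) = coeq X \<phi>"
| "eq X (And \<phi> \<psi>) = Eq X (eq X \<phi> \<union> eq X \<psi>)"
| "eq X (Or \<phi> \<psi>) = eq X \<phi> \<inter> eq X \<psi>"
| "eq X (Ex x \<phi>) = Eq X (eq X \<phi> \<inter> (X - {x}) \<times> (X - {x}))"
| "coeq X One = Id_on X"
| "coeq X (Atom r xs) = Id_on X"
| "coeq X (Equal x y) = Id_on X"
| "coeq X (Neg \<phi>) = eq X \<phi>"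
| "coeq X (And \<phi> \<psi>) = coeq X \<phi> \<inter> coeq X \<psi>"
| "coeq X (Or \<phi> \<psi>) = Eq X (coeq X \<phi> \<union> coeq X \<psi>)"
| "coeq X (Ex x \<phi>) = Eq X (coeq X \<phi> \<inter> (X - {x}) \<times> (X - {x}))"

lemma eq_coeq_Or:
  "eq X (Or \<phi> \<psi>) = eq X (Neg (And (Neg \<phi>) (Neg \<psi>)))"
  "coeq X (Or \<phi> \<psi>) = coeq X (Neg (And (Neg \<phi>) (Neg \<psi>)))"
  by simp_all

text \<open>The closure \<open>cl\<^sub>E(Y)\<close> of \<open>Y\<close> under \<open>E\<close> is the relational image \<open>E `` Y\<close>.\<close>

fun gen\<^sub>0 cogen\<^sub>0 :: "'x set \<Rightarrow> ('r, 'x) fm \<Rightarrow> 'x set" where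
  "gen\<^sub>0 X One = {}"
| "gen\<^sub>0 X (Atom r xs) = set xs"
| "gen\<^sub>0 X (Equal x y) = {}"
| "gen\<^sub>0 X (Neg \<phi>) = cogen\<^sub>0 X \<phi>"
| "gen\<^sub>0 X (And \<phi> \<psi>) = eq X (And \<phi> \<psi>) `` (gen\<^sub>0 X \<phi> \<union> gen\<^sub>0 X \<psi>)"
| "gen\<^sub>0 X (Or \<phi> \<psi>) = gen\<^sub>0 X \<phi> \<inter> gen\<^sub>0 X \<psi>"
| "gen\<^sub>0 X (Ex x \<phi>) = gen\<^sub>0 X \<phi> - {x}"
| "cogen\<^sub>0 X One = {}"
| "cogen\<^sub>0 X (Atom r xs) = {}"
| "cogen\<^sub>0 X (Equal x y) = {}"
| "cogen\<^sub>0 X (Neg \<phi>) = gen\<^sub>0 X \<phi>"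
| "cogen\<^sub>0 X (And \<phi> \<psi>) = cogen\<^sub>0 X \<phi> \<inter> cogen\<^sub>0 X \<psi>"
| "cogen\<^sub>0 X (Or \<phi> \<psi>) = coeq X (Or \<phi> \<psi>) `` (cogen\<^sub>0 X \<phi> \<union> cogen\<^sub>0 X \<psi>)"
| "cogen\<^sub>0 X (Ex x \<phi>) = cogen\<^sub>0 X \<phi> - {x}"

lemma gen_cogen_Or:
  "gen\<^sub>0 X (Or \<phi> \<psi>) = gen\<^sub>0 X (Neg (And (Neg \<phi>) (Neg \<psi>)))"
  "cogen\<^sub>0 X (Or \<phi> \<psi>) = cogen\<^sub>0 X (Neg (And (Neg \<phi>) (Neg \<psi>)))"
  by simp_all

definition allowed :: "'x set \<Rightarrow> ('r, 'x) fm \<Rightarrow> bool" where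
  "allowed X \<phi> \<longleftrightarrow> FV \<phi> = gen\<^sub>0 X \<phi> \<and> (\<forall>x \<psi>. Ex x \<psi> \<in> subformulas \<phi> \<longrightarrow> x \<in> gen\<^sub>0 X \<psi>)"

end

theory Submission
  imports Defs
begin

text \<open>
  A valuation satisfying \<open>\<phi>\<close> identifies the variables related by \<open>eq\<close> and sends \<open>gen\<^sub>0\<close> into the
  active domain, the set of elements that occur in some relation (dually for \<open>coeq\<close>, \<open>cogen\<^sub>0\<close> and
  valuations that falsify \<open>\<phi>\<close>). So if every quantified variable is generated, witnesses lie in the
  active domain, which is contained in both domains, and valuations of \<open>M\<^sub>1\<close> and \<open>M\<^sub>2\<close> that agree
  on the free variables satisfy the same formulas. Since the free variables of an allowed formula
  are themselves generated, a satisfying valuation can be transferred to the other structure.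
\<close>

lemma Eq_least: "equiv X E \<Longrightarrow> S \<subseteq> E \<Longrightarrow> Eq X S \<subseteq> E"
  unfolding Eq_def by blast

text \<open>The hypothesis puts the full relation \<open>X \<times> X\<close> into the family
  intersected by \<open>Eq\<close>. Otherwise that family would be empty and its intersection the
  whole type.\<close>

lemma Eq_subset: "S \<subseteq> X \<times> X \<Longrightarrow> Eq X S \<subseteq> X \<times> X"
  by (rule Eq_least) (auto simp: equiv_def refl_on_def sym_def trans_def)

lemma eq_coeq_subset:
  "is_formula R \<delta> X \<phi> \<Longrightarrow> eq X \<phi> \<subseteq> X \<times> X \<and> coeq X \<phi> \<subseteq> X \<times> X"
proof (induction \<phi>)
  case (Ex x \<phi>)
  then show ?case
    by (simp add: Eq_subset le_infI2 Sigma_mono)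
qed (simp_all add: Eq_subset Id_on_subset_Times le_infI1)

text \<open>\<open>agree_off\<close> relates valuations only inside \<open>X\<close>, so using it on
  generated variables requires knowing that they lie there.\<close>

lemma gen_cogen_subset:
  "is_formula R \<delta> X \<phi> \<Longrightarrow> gen\<^sub>0 X \<phi> \<subseteq> X \<and> cogen\<^sub>0 X \<phi> \<subseteq> X"
proof (induction \<phi>)
  case (And \<phi> \<psi>)
  then show ?case
    using eq_coeq_subset[OF And.prems] by (auto simp del: eq.simps)
next
  case (Or \<phi> \<psi>)
  then show ?case
    using eq_coeq_subset[OF Or.prems] by (auto simp del: coeq.simps)
qed auto

text \<open>The kernel of \<open>v\<close>, cut down to \<open>X\<close> so that it is a candidate
  in the intersection defining \<open>Eq\<close>.\<close>

definition ker_on :: "'x set \<Rightarrow> ('x \<Rightarrow> 'a) \<Rightarrow> ('x \<times> 'x) set" where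
  "ker_on X v = {(x, y). x \<in> X \<and> y \<in> X \<and> v x = v y}"

lemma equiv_ker_on: "equiv X (ker_on X v)"
  by (auto simp: ker_on_def equiv_def refl_on_def sym_def trans_def)

text \<open>The kernel is an equivalence on \<open>X\<close>, so closing \<open>S\<close> under
  \<open>Eq\<close> cannot leave it. Each clause built with \<open>Eq\<close> thus reduces to its
  generating pairs.\<close>

lemma Eq_subset_ker_on_iff:
  "Eq X S \<subseteq> ker_on X v \<longleftrightarrow> S \<subseteq> ker_on X v"
  using Eq_least[OF equiv_ker_on] by (auto simp: Eq_def)

lemma Id_on_subset_ker_on: "Id_on X \<subseteq> ker_on X v"
  by (auto simp: ker_on_def)

lemma val_subset_valuations: "val X M \<phi> \<subseteq> valuations X M"
  by (induction \<phi>) (auto simp: diag_def cyl_def)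

lemma FV_subset: "is_formula R \<delta> X \<phi> \<Longrightarrow> FV \<phi> \<subseteq> X"
  by (induction \<phi>) auto

lemma subset_cyl: "V \<subseteq> valuations X M \<Longrightarrow> V \<subseteq> cyl X M x V"
  by (auto simp: cyl_def agree_off_def)

text \<open>Negation exchanges \<open>eq\<close> and \<open>coeq\<close>, so both halves share one
  induction. In a false conjunction some conjunct fails, and the intersection lies inside the
  \<open>coeq\<close> of that conjunct; disjunction is dual.\<close>

lemma eq_coeq_sound:
  assumes "is_formula R \<delta> X \<phi>" and "v \<in> valuations X M"
  shows "(v \<in> val X M \<phi> \<longrightarrow> eq X \<phi> \<subseteq> ker_on X v) \<and>
         (v \<notin> val X M \<phi> \<longrightarrow> coeq X \<phi> \<subseteq> ker_on X v)"
  using assms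
proof (induction \<phi> arbitrary: v)
  case (Equal x y)
  then show ?case
    by (auto simp: Eq_subset_ker_on_iff Id_on_subset_ker_on diag_def) (auto simp: ker_on_def)
next
  case (And \<phi> \<psi>)
  then have "v \<in> val X M \<phi> \<longrightarrow> eq X \<phi> \<subseteq> ker_on X v"
    "v \<in> val X M \<psi> \<longrightarrow> eq X \<psi> \<subseteq> ker_on X v"
    "v \<notin> val X M \<phi> \<longrightarrow> coeq X \<phi> \<subseteq> ker_on X v"
    "v \<notin> val X M \<psi> \<longrightarrow> coeq X \<psi> \<subseteq> ker_on X v"
    by simp_all
  then show ?case
    by (auto simp: Eq_subset_ker_on_iff)
next
  case (Or \<phi> \<psi>)
  then have "v \<in> val X M \<phi> \<longrightarrow> eq X \<phi> \<subseteq> ker_on X v"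
    "v \<in> val X M \<psi> \<longrightarrow> eq X \<psi> \<subseteq> ker_on X v"
    "v \<notin> val X M \<phi> \<longrightarrow> coeq X \<phi> \<subseteq> ker_on X v"
    "v \<notin> val X M \<psi> \<longrightarrow> coeq X \<psi> \<subseteq> ker_on X v"
    by simp_all
  then show ?case
    by (auto simp: Eq_subset_ker_on_iff)
next
  case (Ex x \<phi>)
  \<comment> \<open>The witness \<open>u\<close> may differ from \<open>v\<close> at
    \<open>x\<close>, so only pairs avoiding \<open>x\<close> carry over from its kernel.\<close>
  have "eq X \<phi> \<inter> (X - {x}) \<times> (X - {x}) \<subseteq> ker_on X v" if v: "v \<in> cyl X M x (val X M \<phi>)"
  proof -
    obtain u where "u \<in> val X M \<phi>" and u: "agree_off X x u v"
      using v by (auto simp: cyl_def)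
    then have "eq X \<phi> \<subseteq> ker_on X u"
      using Ex.IH[of u] Ex.prems val_subset_valuations[of X M \<phi>] by auto
    then show ?thesis
      using u by (fastforce simp: ker_on_def agree_off_def)
  qed
  \<comment> \<open>Outside the cylinder \<open>v\<close> falsifies the body, since otherwise it
    would be its own witness; the induction hypothesis applies to \<open>v\<close> directly.\<close>
  moreover have "coeq X \<phi> \<subseteq> ker_on X v" if "v \<notin> cyl X M x (val X M \<phi>)"
    using that Ex.IH[of v] Ex.prems subset_cyl[OF val_subset_valuations, of X M \<phi> x] by auto
  ultimately show ?case
    by (auto simp: Eq_subset_ker_on_iff)
qed (simp_all add: Id_on_subset_ker_on)

definition active_domain :: "'r set \<Rightarrow> ('a, 'r) struct \<Rightarrow> 'a set" where
  "active_domain R M = (\<Union>r\<in>R. \<Union>as\<in>rel M r. set as)"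

lemma active_domain_subset: "is_structure R \<delta> M \<Longrightarrow> active_domain R M \<subseteq> dom M"
  by (fastforce simp: is_structure_def active_domain_def)

lemma active_domain_cong:
  "differ_only_in_domains R M\<^sub>1 M\<^sub>2 \<Longrightarrow> active_domain R M\<^sub>1 = active_domain R M\<^sub>2"
  by (simp add: differ_only_in_domains_def active_domain_def)

text \<open>Related variables have equal values, so closing \<open>Y\<close> under \<open>E\<close>
  adds no new value.\<close>

lemma ker_on_Image_subset:
  "E \<subseteq> ker_on X v \<Longrightarrow> v ` Y \<subseteq> A \<Longrightarrow> v ` (E `` Y) \<subseteq> A"
  by (fastforce simp: ker_on_def)

text \<open>Values enter the active domain at atoms. Closures preserve this because, by
  \<open>eq_coeq_sound\<close>, the valuation respects the equalities along which they
  spread.\<close>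

lemma gen_cogen_sound:
  assumes "is_formula R \<delta> X \<phi>" and "v \<in> valuations X M"
  shows "(v \<in> val X M \<phi> \<longrightarrow> v ` gen\<^sub>0 X \<phi> \<subseteq> active_domain R M) \<and>
         (v \<notin> val X M \<phi> \<longrightarrow> v ` cogen\<^sub>0 X \<phi> \<subseteq> active_domain R M)"
  using assms
proof (induction \<phi> arbitrary: v)
  case (Atom r xs)
  then show ?case
    by (force simp: active_domain_def)
next
  case (And \<phi> \<psi>)
  have IH: "v \<in> val X M \<phi> \<longrightarrow> v ` gen\<^sub>0 X \<phi> \<subseteq> active_domain R M"
    "v \<in> val X M \<psi> \<longrightarrow> v ` gen\<^sub>0 X \<psi> \<subseteq> active_domain R M"
    "v \<notin> val X M \<phi> \<longrightarrow> v ` cogen\<^sub>0 X \<phi> \<subseteq> active_domain R M"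
    "v \<notin> val X M \<psi> \<longrightarrow> v ` cogen\<^sub>0 X \<psi> \<subseteq> active_domain R M"
    using And by simp_all
  have "v ` (eq X (And \<phi> \<psi>) `` (gen\<^sub>0 X \<phi> \<union> gen\<^sub>0 X \<psi>)) \<subseteq> active_domain R M"
    if "v \<in> val X M (And \<phi> \<psi>)"
    using that IH eq_coeq_sound[OF And.prems]
    by (intro ker_on_Image_subset[of _ X]) (simp_all del: eq.simps add: image_Un)
  then show ?case
    using IH by auto
next
  case (Or \<phi> \<psi>)
  have IH: "v \<in> val X M \<phi> \<longrightarrow> v ` gen\<^sub>0 X \<phi> \<subseteq> active_domain R M"
    "v \<in> val X M \<psi> \<longrightarrow> v ` gen\<^sub>0 X \<psi> \<subseteq> active_domain R M"
    "v \<notin> val X M \<phi> \<longrightarrow> v ` cogen\<^sub>0 X \<phi> \<subseteq> active_domain R M"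
    "v \<notin> val X M \<psi> \<longrightarrow> v ` cogen\<^sub>0 X \<psi> \<subseteq> active_domain R M"
    using Or by simp_all
  have "v ` (coeq X (Or \<phi> \<psi>) `` (cogen\<^sub>0 X \<phi> \<union> cogen\<^sub>0 X \<psi>)) \<subseteq> active_domain R M"
    if "v \<notin> val X M (Or \<phi> \<psi>)"
    using that IH eq_coeq_sound[OF Or.prems]
    by (intro ker_on_Image_subset[of _ X]) (simp_all del: coeq.simps add: image_Un)
  then show ?case
    using IH by auto
next
  case (Ex x \<phi>)
  have "v ` (gen\<^sub>0 X \<phi> - {x}) \<subseteq> active_domain R M" if v: "v \<in> cyl X M x (val X M \<phi>)"
  proof -
    obtain u where "u \<in> val X M \<phi>" and u: "agree_off X x u v"
      using v by (auto simp: cyl_def)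
    then have "u ` gen\<^sub>0 X \<phi> \<subseteq> active_domain R M"
      using Ex.IH[of u] Ex.prems val_subset_valuations[of X M \<phi>] by auto
    moreover have "gen\<^sub>0 X \<phi> \<subseteq> X"
      using gen_cogen_subset[of R \<delta> X \<phi>] Ex.prems by auto
    moreover have "v ` (gen\<^sub>0 X \<phi> - {x}) = u ` (gen\<^sub>0 X \<phi> - {x})" if "gen\<^sub>0 X \<phi> \<subseteq> X"
      using u that by (intro image_cong) (auto simp: agree_off_def)
    ultimately show ?thesis
      by auto
  qed
  moreover have "v ` cogen\<^sub>0 X \<phi> \<subseteq> active_domain R M" if "v \<notin> cyl X M x (val X M \<phi>)"
    using that Ex.IH[of v] Ex.prems subset_cyl[OF val_subset_valuations, of X M \<phi> x] by auto
  ultimately show ?case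
    by auto
qed auto

text \<open>Only the value at \<open>x\<close> of a witness over \<open>M\<^sub>1\<close> is reused:
  \<open>x\<close> is generated, so this value is in the active domain and hence in
  \<open>dom M\<^sub>2\<close>. The premise \<open>transfer\<close> stands for one direction of the
  induction hypothesis of \<open>val_agree\<close>.\<close>

lemma cyl_val_transfer:
  assumes "is_structure R \<delta> M\<^sub>2" and "differ_only_in_domains R M\<^sub>1 M\<^sub>2"
    and "is_formula R \<delta> X \<phi>" and "x \<in> X" and "x \<in> gen\<^sub>0 X \<phi>"
    and "v \<in> cyl X M\<^sub>1 x (val X M\<^sub>1 \<phi>)" and "w \<in> valuations X M\<^sub>2"
    and "\<forall>y \<in> FV \<phi> - {x}. v y = w y"
    and transfer: "\<And>u u'. u \<in> val X M\<^sub>1 \<phi> \<Longrightarrow> u' \<in> valuations X M\<^sub>2 \<Longrightarrow>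
      \<forall>y \<in> FV \<phi>. u y = u' y \<Longrightarrow> u' \<in> val X M\<^sub>2 \<phi>"
  shows "w \<in> cyl X M\<^sub>2 x (val X M\<^sub>2 \<phi>)"
proof -
  obtain u where u: "u \<in> val X M\<^sub>1 \<phi>" "agree_off X x u v"
    using assms by (auto simp: cyl_def)
  have "u x \<in> active_domain R M\<^sub>1"
    using gen_cogen_sound[of R \<delta> X \<phi> u M\<^sub>1] u assms val_subset_valuations[of X M\<^sub>1 \<phi>] by auto
  then have "u x \<in> dom M\<^sub>2"
    using active_domain_cong[OF assms(2)] active_domain_subset[OF assms(1)] by auto
  then have *: "w(x := u x) \<in> valuations X M\<^sub>2"
    using assms by (auto simp: valuations_def PiE_iff extensional_def)
  \<comment> \<open>At \<open>x\<close> this holds by construction; elsewhere \<open>u\<close>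
    agrees with \<open>v\<close> inside \<open>X\<close>, and \<open>v\<close> with \<open>w\<close>
    on free variables.\<close>
  have "\<forall>y \<in> FV \<phi>. u y = (w(x := u x)) y"
    using u(2) assms FV_subset[of R \<delta> X \<phi>] by (auto simp: agree_off_def)
  then have "w(x := u x) \<in> val X M\<^sub>2 \<phi>"
    by (rule transfer[OF u(1) *])
  moreover have "agree_off X x (w(x := u x)) w"
    by (simp add: agree_off_def)
  ultimately show ?thesis
    using assms(7) unfolding cyl_def by blast
qed

text \<open>The induction uses the half of \<open>allowed\<close> that subformulas inherit. The half
  \<open>FV \<phi> = gen\<^sub>0 X \<phi>\<close> can fail for them, as it does for a conjunct
  \<open>Equal x y\<close>.\<close>

lemma val_agree:
  assumes "is_structure R \<delta> M\<^sub>1" and "is_structure R \<delta> M\<^sub>2" and "differ_only_in_domains R M\<^sub>1 M\<^sub>2"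
    and "is_formula R \<delta> X \<phi>" and "\<forall>x \<psi>. Ex x \<psi> \<in> subformulas \<phi> \<longrightarrow> x \<in> gen\<^sub>0 X \<psi>"
    and "v \<in> valuations X M\<^sub>1" and "w \<in> valuations X M\<^sub>2" and "\<forall>x \<in> FV \<phi>. v x = w x"
  shows "v \<in> val X M\<^sub>1 \<phi> \<longleftrightarrow> w \<in> val X M\<^sub>2 \<phi>"
  using assms(4-)
proof (induction \<phi> arbitrary: v w)
  case (Atom r xs)
  then have "map v xs = map w xs"
    by simp
  moreover have "rel M\<^sub>1 r = rel M\<^sub>2 r"
    using Atom assms(3) by (simp add: differ_only_in_domains_def)
  ultimately show ?case
    using Atom.prems(3,4) by (simp del: map_eq_conv)
next
  case (Equal x y)
  then show ?case
    by (simp add: diag_def)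
next
  case (Ex x \<phi>)
  have IH: "u \<in> val X M\<^sub>1 \<phi> \<longleftrightarrow> u' \<in> val X M\<^sub>2 \<phi>"
    if "u \<in> valuations X M\<^sub>1" "u' \<in> valuations X M\<^sub>2" "\<forall>y \<in> FV \<phi>. u y = u' y" for u u'
    using Ex.IH[of u u'] Ex.prems that by auto
  have sym: "differ_only_in_domains R M\<^sub>2 M\<^sub>1"
    using assms(3) by (simp add: differ_only_in_domains_def)
  have x: "is_formula R \<delta> X \<phi>" "x \<in> X" "x \<in> gen\<^sub>0 X \<phi>"
    using Ex.prems by auto
  show ?case
    unfolding val.simps
  proof
    assume "v \<in> cyl X M\<^sub>1 x (val X M\<^sub>1 \<phi>)"
    then show "w \<in> cyl X M\<^sub>2 x (val X M\<^sub>2 \<phi>)"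
      using Ex.prems IH val_subset_valuations[of X M\<^sub>1 \<phi>]
      by (intro cyl_val_transfer[OF assms(2,3) x]) auto
  next
    assume "w \<in> cyl X M\<^sub>2 x (val X M\<^sub>2 \<phi>)"
    then show "v \<in> cyl X M\<^sub>1 x (val X M\<^sub>1 \<phi>)"
      using Ex.prems IH val_subset_valuations[of X M\<^sub>2 \<phi>]
      by (intro cyl_val_transfer[OF assms(1) sym x, of w v]) auto
  qed
next
  case (Neg \<phi>)
  show ?case
    using Neg.prems Neg.IH[of v w] by auto
next
  case (And \<phi> \<psi>)
  show ?case
    using And.prems And.IH(1)[of v w] And.IH(2)[of v w] by auto
next
  case (Or \<phi> \<psi>)
  show ?case
    using Or.prems Or.IH(1)[of v w] Or.IH(2)[of v w] by auto
qed simp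

text \<open>Here \<open>FV \<phi> = gen\<^sub>0 X \<phi>\<close> enters: it places the values of the
  free variables in the active domain, so they exist in \<open>M\<^sub>2\<close> too.\<close>

lemma proj_val_subset:
  assumes "is_structure R \<delta> M\<^sub>1" and M2: "is_structure R \<delta> M\<^sub>2" and "differ_only_in_domains R M\<^sub>1 M\<^sub>2"
    and "is_formula R \<delta> X \<phi>" and "allowed X \<phi>"
  shows "proj (FV \<phi>) (val X M\<^sub>1 \<phi>) \<subseteq> proj (FV \<phi>) (val X M\<^sub>2 \<phi>)"
proof -
  have "restrict v (FV \<phi>) \<in> proj (FV \<phi>) (val X M\<^sub>2 \<phi>)" if v: "v \<in> val X M\<^sub>1 \<phi>" for v
  proof -
    have v': "v \<in> valuations X M\<^sub>1"
      using v val_subset_valuations by blast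
    obtain d where d: "d \<in> dom M\<^sub>2"
      using M2 by (auto simp: is_structure_def)
    \<comment> \<open>Off the free variables \<open>v\<close> may take values outside
      \<open>dom M\<^sub>2\<close>, so they are replaced by an arbitrary element \<open>d\<close>;
      restricting to \<open>X\<close> makes \<open>w\<close> extensional.\<close>
    define w where "w = restrict (\<lambda>x. if x \<in> FV \<phi> then v x else d) X"
    have "v ` FV \<phi> \<subseteq> active_domain R M\<^sub>1"
      using gen_cogen_sound[of R \<delta> X \<phi> v M\<^sub>1] v v' assms by (auto simp: allowed_def)
    then have "v ` FV \<phi> \<subseteq> dom M\<^sub>2"
      using active_domain_cong[OF assms(3)] active_domain_subset[OF M2] by auto
    then have w: "w \<in> valuations X M\<^sub>2"
      using d by (auto simp: w_def valuations_def image_subset_iff)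
    have vw: "\<forall>x \<in> FV \<phi>. v x = w x"
      using FV_subset[OF assms(4)] by (auto simp: w_def)
    then have "w \<in> val X M\<^sub>2 \<phi>"
      using val_agree[OF assms(1-4) _ v' w vw] v assms(5) by (simp add: allowed_def)
    moreover have "restrict v (FV \<phi>) = restrict w (FV \<phi>)"
      using vw by (auto simp: restrict_def)
    ultimately show ?thesis
      by (auto simp: proj_def)
  qed
  then show ?thesis
    by (auto simp: proj_def)
qed

theorem theorem6p9:
  fixes R :: "'r set" and \<delta> :: "'r \<Rightarrow> nat"
    and X :: "'x::linorder set" and \<phi> :: "('r, 'x) fm"
  assumes "finite R" and "finite X"
    and "is_formula R \<delta> X \<phi>"
    and "allowed X \<phi>"
  shows "domain_independent TYPE('a) R \<delta> X \<phi>"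
  unfolding domain_independent_def
proof (intro allI impI subset_antisym)
  fix M\<^sub>1 M\<^sub>2 :: "('a, 'r) struct"
  assume M: "is_structure R \<delta> M\<^sub>1" "is_structure R \<delta> M\<^sub>2" "differ_only_in_domains R M\<^sub>1 M\<^sub>2"
  then have sym: "differ_only_in_domains R M\<^sub>2 M\<^sub>1"
    by (simp add: differ_only_in_domains_def)
  show "proj (FV \<phi>) (val X M\<^sub>1 \<phi>) \<subseteq> proj (FV \<phi>) (val X M\<^sub>2 \<phi>)"
    by (rule proj_val_subset[OF M assms(3,4)])
  show "proj (FV \<phi>) (val X M\<^sub>2 \<phi>) \<subseteq> proj (FV \<phi>) (val X M\<^sub>1 \<phi>)"
    by (rule proj_val_subset[OF M(2,1) sym assms(3,4)])
qed

end
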